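(* Let $\mathcal{G}$ be any finite set of mutually non-isomorphic (not necessarily connected) graphs. Then $\mathcal{G}$ is uniformly distinguishable; that is, there exists a single graph $H$ such that $X_{G_1}^H \neq X_{G_2}^H$ for any two distinct $G_1, G_2 \in \mathcal{G}$.
   Context: All graphs are finite, simple, undirected, with at least one vertex. $H$-chromatic symmetric function: let $G,H$ be graphs with $|V(G)|=k$, $|V(H)|=n$. A labeling of $H$ is a bijection $\phi:V(H)\to[n]$. A proper $(H,\phi)$-coloring of $G$ is a map $\kappa:V(G)\to[n]$ such that whenever $u,v$ are adjacent in $G$, $\phi^{-1}(\kappa(u))$ and $\phi^{-1}(\kappa(v))$ are adjacent in $H$. Put $w_G^H=\sum_\phi\sum_\kappa\prod_{v\in V(G)}x_{\kappa(v)}$, summed over all labelings $\phi$ and all proper $(H,\phi)$-colorings $\kappa$. This is a symmetric polynomial in $x_1,\dots,x_n$, homogeneous of degree $k$; writing $w_G^H=\sum_{\lambda\vdash k,\,l(\lambda)\le n}c_\lambda m_\lambda(x_1,\dots,x_n)$ (with $m_\lambda$ the monomial symmetric functions and $l(\lambda)$ the number of parts), define $X_G^H=\sum_{\lambda\vdash k,\,l(\lambda)\le n}c_\lambda m_\lambda\in\Lambda^k$ (so $X_G^H=0$ if there are no proper colorings). For a set $\mathcal G$ of mutually non-isomorphic graphs, a set of graphs $\mathcal H$ is a $\mathcal G$-distinguisher if for any two distinct $G_1,G_2\in\mathcal G$ there is $H\in\mathcal H$ with $X_{G_1}^H\ne X_{G_2}^H$. $\mathcal G$ is uniformly distinguishable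 if there is a $\mathcal G$-distinguisher consisting of exactly one graph. *)

theory Defs
  imports
    "Graph_Theory.Pair_Digraph"
    "Graph_Theory.Digraph_Isomorphism"
    "HOL-Library.Poly_Mapping"
    "HOL-Library.Multiset"
    "HOL-Library.FuncSet"
    "HOL-Combinatorics.Permutations"
begin

section \<open>Graphs\<close>

text \<open>An undirected edge is represented by the two arcs in opposite directions;
  \<^const>\<open>pair_graph\<close> demands finiteness, symmetry and the absence of loops.\<close>

definition simple_graph :: "'a pair_pre_digraph \<Rightarrow> bool" where
  "simple_graph G \<longleftrightarrow> pair_graph G \<and> pverts G \<noteq> {}"

definition graph_isomorphic :: "'a pair_pre_digraph \<Rightarrow> 'b pair_pre_digraph \<Rightarrow> bool" where
  "graph_isomorphic G H \<longleftrightarrow> digraph_iso (with_proj G) (with_proj H)"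

section \<open>Monomial symmetric functions\<close>

text \<open>A monomial is its exponent vector. Polynomials have finitely many monomials; a
  symmetric function, being a formal power series in \<open>x\<^sub>1, x\<^sub>2, \<dots>\<close>, is given by its
  coefficients. The variables are indexed from 1, so the index 0 never occurs.\<close>

type_synonym monomial = "nat \<Rightarrow>\<^sub>0 nat"
type_synonym polynomial = "monomial \<Rightarrow>\<^sub>0 int"
type_synonym sym_fun = "monomial \<Rightarrow> int"

definition var :: "nat \<Rightarrow> polynomial" where
  "var i = Poly_Mapping.single (Poly_Mapping.single i 1) 1"

definition const :: "int \<Rightarrow> polynomial" where
  "const a = Poly_Mapping.single 0 a"

definition exponents :: "monomial \<Rightarrow> nat multiset" where
  "exponents \<alpha> = image_mset (Poly_Mapping.lookup \<alpha>) (mset_set (Poly_Mapping.keys \<alpha>))"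

text \<open>A partition is the multiset of its parts.\<close>

definition partitions :: "nat \<Rightarrow> nat multiset set" where
  "partitions k = {\<mu>. 0 \<notin># \<mu> \<and> sum_mset \<mu> = k}"

definition partitions_le :: "nat \<Rightarrow> nat \<Rightarrow> nat multiset set" where
  "partitions_le k n = {\<mu> \<in> partitions k. size \<mu> \<le> n}"

definition monomial_sym_poly :: "nat \<Rightarrow> nat multiset \<Rightarrow> polynomial" where
  "monomial_sym_poly n \<mu> =
     (\<Sum>\<alpha> | Poly_Mapping.keys \<alpha> \<subseteq> {1..n} \<and> exponents \<alpha> = \<mu>. Poly_Mapping.single \<alpha> 1)"

definition monomial_sym_fun :: "nat multiset \<Rightarrow> sym_fun" where
  "monomial_sym_fun \<mu> =
     (\<lambda>\<alpha>. if Poly_Mapping.keys \<alpha> \<subseteq> {1..} \<and> exponents \<alpha> = \<mu> then 1 else 0)"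

section \<open>The \<open>H\<close>-chromatic symmetric function\<close>

text \<open>Labelings and colorings are taken extensional, so that they correspond to
  functions on the vertex set.\<close>

definition labelings :: "'b pair_pre_digraph \<Rightarrow> ('b \<Rightarrow> nat) set" where
  "labelings H = {\<phi> \<in> pverts H \<rightarrow>\<^sub>E {1..card (pverts H)}.
     bij_betw \<phi> (pverts H) {1..card (pverts H)}}"

definition proper_colorings ::
    "'a pair_pre_digraph \<Rightarrow> 'b pair_pre_digraph \<Rightarrow> ('b \<Rightarrow> nat) \<Rightarrow> ('a \<Rightarrow> nat) set" where
  "proper_colorings G H \<phi> = {\<kappa> \<in> pverts G \<rightarrow>\<^sub>E {1..card (pverts H)}.
     \<forall>u v. (u, v) \<in> parcs G \<longrightarrow>
       (the_inv_into (pverts H) \<phi> (\<kappa> u), the_inv_into (pverts H) \<phi> (\<kappa> v)) \<in> parcs H}"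

definition chromatic_poly :: "'a pair_pre_digraph \<Rightarrow> 'b pair_pre_digraph \<Rightarrow> polynomial" where
  "chromatic_poly G H =
     (\<Sum>\<phi>\<in>labelings H. \<Sum>\<kappa>\<in>proper_colorings G H \<phi>. \<Prod>v\<in>pverts G. var (\<kappa> v))"

definition is_chromatic_coeff ::
    "'a pair_pre_digraph \<Rightarrow> 'b pair_pre_digraph \<Rightarrow> (nat multiset \<Rightarrow> int) \<Rightarrow> bool" where
  "is_chromatic_coeff G H c \<longleftrightarrow>
     (let P = partitions_le (card (pverts G)) (card (pverts H)) in
       chromatic_poly G H
         = (\<Sum>\<mu>\<in>P. const (c \<mu>) * monomial_sym_poly (card (pverts H)) \<mu>)
       \<and> (\<forall>\<mu>. \<mu> \<notin> P \<longrightarrow> c \<mu> = 0))"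

text \<open>The coefficients exist and are unique, see \<open>ex1_chromatic_coeff\<close> below.\<close>

definition chromatic_coeff ::
    "'a pair_pre_digraph \<Rightarrow> 'b pair_pre_digraph \<Rightarrow> nat multiset \<Rightarrow> int" where
  "chromatic_coeff G H = (THE c. is_chromatic_coeff G H c)"

definition chromatic_sym_fun :: "'a pair_pre_digraph \<Rightarrow> 'b pair_pre_digraph \<Rightarrow> sym_fun" where
  "chromatic_sym_fun G H =
     (\<lambda>\<alpha>. \<Sum>\<mu>\<in>partitions_le (card (pverts G)) (card (pverts H)).
        chromatic_coeff G H \<mu> * monomial_sym_fun \<mu> \<alpha>)"

section \<open>Distinguishers\<close>

definition distinguisher :: "'a pair_pre_digraph set \<Rightarrow> 'b pair_pre_digraph set \<Rightarrow> bool" where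
  "distinguisher \<G> \<H> \<longleftrightarrow> (\<forall>H\<in>\<H>. simple_graph H) \<and>
     (\<forall>G\<^sub>1\<in>\<G>. \<forall>G\<^sub>2\<in>\<G>. G\<^sub>1 \<noteq> G\<^sub>2 \<longrightarrow>
       (\<exists>H\<in>\<H>. chromatic_sym_fun G\<^sub>1 H \<noteq> chromatic_sym_fun G\<^sub>2 H))"

text \<open>Every finite graph is isomorphic to one whose vertices are natural numbers, so
  nothing is lost by letting the distinguishing graph live on that type.\<close>

definition uniformly_distinguishable :: "'a pair_pre_digraph set \<Rightarrow> bool" where
  "uniformly_distinguishable \<G> \<longleftrightarrow>
     (\<exists>\<H> :: nat pair_pre_digraph set. distinguisher \<G> \<H> \<and> card \<H> = 1)"

section \<open>Well-definedness of the coefficients\<close>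

lemma finite_partitions_le: "finite (partitions_le k n)"
proof (rule finite_subset)
  show "partitions_le k n \<subseteq> mset ` {xs. set xs \<subseteq> {..k} \<and> length xs \<le> n}"
  proof
    fix l assume l: "l \<in> partitions_le k n"
    obtain xs where xs: "l = mset xs" using ex_mset by metis
    have "x \<le> k" if "x \<in> set xs" for x
      using that l member_le_sum_list[of x xs]
      by (auto simp: partitions_le_def partitions_def xs sum_mset_sum_list)
    then show "l \<in> mset ` {xs. set xs \<subseteq> {..k} \<and> length xs \<le> n}"
      using l by (auto simp: partitions_le_def xs)
  qed
qed (intro finite_imageI finite_lists_length_le finite_atMost)

lemma sum_mset_exponents:
  "sum_mset (exponents \<alpha>) = (\<Sum>i\<in>Poly_Mapping.keys \<alpha>. Poly_Mapping.lookup \<alpha> i)"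
  by (simp add: exponents_def sum_unfold_sum_mset)

lemma exponents_inj_permutes:
  assumes "Poly_Mapping.keys \<alpha> \<subseteq> {1..n}" "Poly_Mapping.keys \<beta> \<subseteq> {1..n}"
    and "exponents \<alpha> = exponents \<beta>"
  obtains p where "p permutes {1..n}"
    "\<And>i. i \<in> {1..n} \<Longrightarrow> Poly_Mapping.lookup \<alpha> i = Poly_Mapping.lookup \<beta> (p i)"
proof -
  have pad: "image_mset (Poly_Mapping.lookup \<gamma>) (mset_set {1..n})
      = exponents \<gamma> + replicate_mset (n - size (exponents \<gamma>)) 0"
    if "Poly_Mapping.keys \<gamma> \<subseteq> {1..n}" for \<gamma> :: monomial
  proof -
    let ?K = "Poly_Mapping.keys \<gamma>"
    have "{1..n} = ?K \<union> ({1..n} - ?K)" using that by auto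
    then have "mset_set {1..n} = mset_set ?K + mset_set ({1..n} - ?K)"
      by (metis Diff_disjoint finite_Diff finite_atLeastAtMost finite_keys mset_set_Union)
    moreover have "image_mset (Poly_Mapping.lookup \<gamma>) (mset_set ({1..n} - ?K))
        = image_mset (\<lambda>_. 0) (mset_set ({1..n} - ?K))"
      by (rule image_mset_cong) (simp add: in_keys_iff)
    ultimately show ?thesis
      using that by (simp add: exponents_def image_mset_const_eq card_Diff_subset)
  qed
  have "image_mset (Poly_Mapping.lookup \<alpha>) (mset_set {1..n})
      = image_mset (Poly_Mapping.lookup \<beta>) (mset_set {1..n})"
    using pad[OF assms(1)] pad[OF assms(2)] assms(3) by simp
  then obtain p where "p permutes {1..n}"
    "\<forall>i\<in>{1..n}. Poly_Mapping.lookup \<alpha> i = Poly_Mapping.lookup \<beta> (p i)"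
    by (rule image_mset_eq_implies_permutes[OF finite_atLeastAtMost])
  with that show thesis by blast
qed

lemma ex_monomial_exponents:
  assumes "\<mu> \<in> partitions_le k n"
  obtains \<alpha> where "Poly_Mapping.keys \<alpha> \<subseteq> {1..n}" "exponents \<alpha> = \<mu>"
proof -
  obtain xs where xs: "\<mu> = mset xs" using ex_mset by metis
  have pos: "\<forall>x\<in>set xs. x \<noteq> 0" and len: "length xs \<le> n"
    using assms by (auto simp: partitions_le_def partitions_def xs intro!: gr0I)
  define f where "f i = (if i \<in> {1..length xs} then xs ! (i - 1) else 0)" for i
  have supp: "{i. f i \<noteq> 0} = {1..length xs}"
    using pos by (auto simp: f_def set_conv_nth)
      (metis Suc_pred less_eq_Suc_le)+
  define \<alpha> where "\<alpha> = Abs_poly_mapping f"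
  have lk: "Poly_Mapping.lookup \<alpha> = f"
    unfolding \<alpha>_def by (rule lookup_Abs_poly_mapping) (simp only: supp finite_atLeastAtMost)
  have keys: "Poly_Mapping.keys \<alpha> = {1..length xs}"
    using supp by (auto simp: in_keys_iff lk)
  have "mset_set {1..length xs} = image_mset Suc (mset_set {0..<length xs})"
    by (subst image_mset_mset_set) (simp_all add: atLeastLessThanSuc_atLeastAtMost)
  then have "exponents \<alpha> = image_mset (\<lambda>i. f (Suc i)) (mset_set {0..<length xs})"
    by (simp add: exponents_def keys lk image_mset.compositionality comp_def)
  also have "\<dots> = image_mset (\<lambda>i. xs ! i) (mset_set {0..<length xs})"
    by (rule image_mset_cong) (simp add: f_def)
  also have "\<dots> = \<mu>"
    unfolding xs by (metis map_nth mset_map mset_upt)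
  finally show thesis using that[of \<alpha>] keys len by simp
qed

lemma prod_var:
  assumes "finite V"
  shows "(\<Prod>v\<in>V. var (\<kappa> v)) = Poly_Mapping.single (\<Sum>v\<in>V. Poly_Mapping.single (\<kappa> v) 1) 1"
  using assms
  by (induction V rule: finite_induct) (simp_all add: var_def mult_single)

lemma lookup_sum_single:
  assumes "finite V"
  shows "Poly_Mapping.lookup (\<Sum>v\<in>V. Poly_Mapping.single (\<kappa> v) (1::nat)) i = card {v \<in> V. \<kappa> v = i}"
  using assms by (simp add: lookup_sum lookup_single when_def sum.If_cases Int_def conj_commute)

lemma lookup_monomial_sym_poly_sum:
  assumes "finite P"
  shows "Poly_Mapping.lookup (\<Sum>\<mu>\<in>P. const (c \<mu>) * monomial_sym_poly n \<mu>) \<alpha>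
    = (if Poly_Mapping.keys \<alpha> \<subseteq> {1..n} \<and> exponents \<alpha> \<in> P then c (exponents \<alpha>) else 0)"
proof -
  have fin: "finite {\<alpha>. Poly_Mapping.keys \<alpha> \<subseteq> {1..n} \<and> exponents \<alpha> = \<mu>}" for \<mu>
  proof (rule finite_subset)
    show "{\<alpha>. Poly_Mapping.keys \<alpha> \<subseteq> {1..n} \<and> exponents \<alpha> = \<mu>}
      \<subseteq> (\<lambda>f. Abs_poly_mapping (\<lambda>i. if i \<in> {1..n} then f i else 0)) ` ({1..n} \<rightarrow>\<^sub>E {..sum_mset \<mu>})"
    proof clarify
      fix \<alpha> assume *: "Poly_Mapping.keys \<alpha> \<subseteq> {1..n}" "\<mu> = exponents \<alpha>"
      have "Poly_Mapping.lookup \<alpha> i \<le> sum_mset (exponents \<alpha>)" for i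
        unfolding sum_mset_exponents
        by (cases "i \<in> Poly_Mapping.keys \<alpha>") (auto intro: member_le_sum simp: in_keys_iff)
      moreover have "(\<lambda>i. if i \<in> {1..n} then restrict (Poly_Mapping.lookup \<alpha>) {1..n} i else 0)
          = Poly_Mapping.lookup \<alpha>"
        using * by (auto simp: fun_eq_iff in_keys_iff)
      then have "\<alpha> = Abs_poly_mapping
          (\<lambda>i. if i \<in> {1..n} then restrict (Poly_Mapping.lookup \<alpha>) {1..n} i else 0)"
        by (simp only: lookup_inverse)
      ultimately show "\<alpha> \<in> (\<lambda>f. Abs_poly_mapping (\<lambda>i. if i \<in> {1..n} then f i else 0)) `
          ({1..n} \<rightarrow>\<^sub>E {..sum_mset (exponents \<alpha>)})"
        by (intro image_eqI[where x = "restrict (Poly_Mapping.lookup \<alpha>) {1..n}"]) auto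
    qed
  qed (simp add: finite_PiE)
  have "Poly_Mapping.lookup (const (c \<mu>) * monomial_sym_poly n \<mu>) \<alpha>
      = (if Poly_Mapping.keys \<alpha> \<subseteq> {1..n} \<and> exponents \<alpha> = \<mu> then c \<mu> else 0)" for \<mu>
    using fin[of \<mu>]
    by (simp add: const_def monomial_sym_poly_def sum_distrib_left mult_single lookup_sum
        lookup_single when_def)
  then have "Poly_Mapping.lookup (\<Sum>\<mu>\<in>P. const (c \<mu>) * monomial_sym_poly n \<mu>) \<alpha>
      = (\<Sum>\<mu>\<in>P. if exponents \<alpha> = \<mu>
          then (if Poly_Mapping.keys \<alpha> \<subseteq> {1..n} then c \<mu> else 0) else 0)"
    unfolding lookup_sum by (intro sum.cong) auto
  then show ?thesis
    using assms by simp
qed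

lemma ex1_chromatic_coeff:
  assumes "simple_graph G" "simple_graph H"
  shows "\<exists>!c. is_chromatic_coeff G H c"
proof -
  define n k where "n = card (pverts H)" and "k = card (pverts G)"
  define V where "V = pverts G"
  define P where "P = partitions_le k n"
  define w where "w = chromatic_poly G H"
  define mon where "mon \<kappa> = (\<Sum>v\<in>V. Poly_Mapping.single (\<kappa> v) (1::nat))" for \<kappa> :: "'a \<Rightarrow> nat"
  interpret G: pair_graph G using assms by (simp add: simple_graph_def)
  interpret H: pair_graph H using assms by (simp add: simple_graph_def)
  have finV: "finite V" by (simp add: V_def)
  have finP: "finite P" by (simp add: P_def finite_partitions_le)
  have finL: "finite (labelings H)"
    by (rule finite_subset[of _ "pverts H \<rightarrow>\<^sub>E {1..n}"])
      (auto simp: labelings_def n_def intro!: finite_PiE)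
  have finC: "finite (proper_colorings G H \<phi>)" for \<phi>
    by (rule finite_subset[of _ "pverts G \<rightarrow>\<^sub>E {1..n}"])
      (auto simp: proper_colorings_def n_def intro!: finite_PiE)
  define S where "S = Sigma (labelings H) (proper_colorings G H)"
  have w_eq: "Poly_Mapping.lookup w \<alpha> = (\<Sum>x\<in>S. if mon (snd x) = \<alpha> then 1 else 0)" for \<alpha>
    unfolding w_def S_def chromatic_poly_def
    using finL finC finV
    by (simp add: lookup_sum prod_var V_def[symmetric] mon_def
        lookup_single when_def sum.Sigma split_def eq_commute)
  have lmon: "Poly_Mapping.lookup (mon \<kappa>) i = card {v \<in> V. \<kappa> v = i}" for \<kappa> i
    unfolding mon_def by (rule lookup_sum_single[OF finV])
  have kmon: "Poly_Mapping.keys (mon \<kappa>) = \<kappa> ` V" for \<kappa>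
    using finV by (auto simp: in_keys_iff lmon)
  have shape: "Poly_Mapping.keys \<alpha> \<subseteq> {1..n} \<and> exponents \<alpha> \<in> P"
    if "Poly_Mapping.lookup w \<alpha> \<noteq> 0" for \<alpha>
  proof -
    have "\<exists>x\<in>S. mon (snd x) = \<alpha>"
    proof (rule ccontr)
      assume "\<not> ?thesis"
      then have "Poly_Mapping.lookup w \<alpha> = 0"
        unfolding w_eq by (intro sum.neutral) auto
      with that show False ..
    qed
    then obtain x where x: "x \<in> S" "mon (snd x) = \<alpha>" by blast
    define \<kappa> where "\<kappa> = snd x"
    have "\<kappa> \<in> V \<rightarrow>\<^sub>E {1..n}"
      using x(1) unfolding \<kappa>_def S_def proper_colorings_def V_def n_def by (cases x) simp
    with x have \<kappa>: "\<kappa> ` V \<subseteq> {1..n}" "mon \<kappa> = \<alpha>"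
      by (auto simp: \<kappa>_def)
    then have keys: "Poly_Mapping.keys \<alpha> \<subseteq> {1..n}" using kmon by auto
    then have "size (exponents \<alpha>) \<le> n"
      using card_mono[OF _ keys] by (simp add: exponents_def)
    moreover have "0 \<notin># exponents \<alpha>" by (auto simp: exponents_def in_keys_iff)
    moreover have "sum_mset (exponents \<alpha>) = k"
    proof -
      have "sum_mset (exponents \<alpha>) = (\<Sum>i\<in>\<kappa> ` V. card {v \<in> V. \<kappa> v = i})"
        unfolding sum_mset_exponents \<kappa>(2)[symmetric] kmon lmon ..
      also have "\<dots> = (\<Sum>i\<in>\<kappa> ` V. \<Sum>v | v \<in> V \<and> \<kappa> v = i. 1)" by simp
      also have "\<dots> = (\<Sum>v\<in>V. 1)"
        by (rule sum.image_gen[symmetric, OF finV])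
      finally show ?thesis by (simp add: k_def V_def)
    qed
    ultimately show ?thesis
      using keys by (simp add: P_def partitions_le_def partitions_def)
  qed
  have act: "(restrict (p \<circ> fst x) (pverts H), restrict (p \<circ> snd x) V) \<in> S"
    if p: "p permutes {1..n}" and x: "x \<in> S" for p x
  proof -
    obtain \<phi> \<kappa> where [simp]: "x = (\<phi>, \<kappa>)" by (cases x)
    have \<phi>: "bij_betw \<phi> (pverts H) {1..n}"
      and \<kappa>: "\<kappa> \<in> V \<rightarrow>\<^sub>E {1..n}"
      and adj: "\<And>u v. (u, v) \<in> parcs G \<Longrightarrow>
        (the_inv_into (pverts H) \<phi> (\<kappa> u), the_inv_into (pverts H) \<phi> (\<kappa> v)) \<in> parcs H"
      using x by (auto simp: S_def labelings_def proper_colorings_def n_def V_def)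
    let ?\<phi> = "restrict (p \<circ> \<phi>) (pverts H)"
    have b: "bij_betw ?\<phi> (pverts H) {1..n}"
      using bij_betw_trans[OF \<phi> permutes_imp_bij[OF p]] by (simp cong: bij_betw_cong)
    have inv: "the_inv_into (pverts H) ?\<phi> (p i) = the_inv_into (pverts H) \<phi> i"
      if "i \<in> {1..n}" for i
    proof (rule the_inv_into_f_eq)
      show "inj_on ?\<phi> (pverts H)" using b by (rule bij_betw_imp_inj_on)
      show mem: "the_inv_into (pverts H) \<phi> i \<in> pverts H"
        using \<phi> that by (metis bij_betw_def order_refl the_inv_into_into)
      show "?\<phi> (the_inv_into (pverts H) \<phi> i) = p i"
        using mem \<phi> that by (simp add: f_the_inv_into_f_bij_betw)
    qed
    have "?\<phi> \<in> labelings H"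
      using b bij_betwE[OF b] by (auto simp: labelings_def n_def[symmetric])
    moreover have "restrict (p \<circ> \<kappa>) V \<in> proper_colorings G H ?\<phi>"
    proof -
      have "restrict (p \<circ> \<kappa>) V \<in> V \<rightarrow>\<^sub>E {1..n}"
        using \<kappa> permutes_in_image[OF p] by auto
      moreover have "(the_inv_into (pverts H) ?\<phi> (restrict (p \<circ> \<kappa>) V u),
          the_inv_into (pverts H) ?\<phi> (restrict (p \<circ> \<kappa>) V v)) \<in> parcs H"
        if uv: "(u, v) \<in> parcs G" for u v
      proof -
        have "u \<in> V" "v \<in> V"
          using G.arc_fst_in_verts[OF uv] G.arc_snd_in_verts[OF uv] by (simp_all add: V_def)
        moreover from this have "\<kappa> u \<in> {1..n}" "\<kappa> v \<in> {1..n}" using \<kappa> by auto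
        ultimately show ?thesis using adj[OF uv] by (simp add: inv)
      qed
      ultimately show ?thesis
        by (simp add: proper_colorings_def n_def[symmetric] V_def[symmetric])
    qed
    ultimately show ?thesis by (simp add: S_def)
  qed
  have act_inv: "(restrict (q \<circ> restrict (p \<circ> fst x) (pverts H)) (pverts H),
      restrict (q \<circ> restrict (p \<circ> snd x) V) V) = x"
    if x: "x \<in> S" and qp: "\<And>i. q (p i) = i" for p q :: "nat \<Rightarrow> nat" and x
  proof -
    have "fst x \<in> extensional (pverts H)" "snd x \<in> extensional V"
      using x by (auto simp: S_def labelings_def proper_colorings_def V_def PiE_def)
    then show ?thesis
      by (auto simp: prod_eq_iff fun_eq_iff restrict_def extensional_def qp)
  qed
  have sym: "Poly_Mapping.lookup w \<alpha> = Poly_Mapping.lookup w \<beta>"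
    if \<alpha>: "Poly_Mapping.keys \<alpha> \<subseteq> {1..n}" and \<beta>: "Poly_Mapping.keys \<beta> \<subseteq> {1..n}"
      and eq: "exponents \<alpha> = exponents \<beta>" for \<alpha> \<beta>
  proof -
    obtain p where p: "p permutes {1..n}"
      and ap: "\<And>i. i \<in> {1..n} \<Longrightarrow> Poly_Mapping.lookup \<alpha> i = Poly_Mapping.lookup \<beta> (p i)"
      using exponents_inj_permutes[OF \<alpha> \<beta> eq] by blast
    have ap': "Poly_Mapping.lookup \<alpha> i = Poly_Mapping.lookup \<beta> (p i)" for i
    proof (cases "i \<in> {1..n}")
      case False
      then have "p i = i" using p by (rule permutes_not_in[rotated])
      moreover have "i \<notin> Poly_Mapping.keys \<alpha>" "i \<notin> Poly_Mapping.keys \<beta>" using False \<alpha> \<beta> by auto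
      ultimately show ?thesis by (simp add: in_keys_iff)
    qed (rule ap)
    define q where "q = inv p"
    have q: "q permutes {1..n}" unfolding q_def by (rule permutes_inv[OF p])
    have qp: "q (p i) = i" and pq: "p (q i) = i" for i
      using p by (simp_all add: q_def permutes_inverses)
    have monp: "mon (restrict (p \<circ> \<kappa>) V) = \<beta> \<longleftrightarrow> mon \<kappa> = \<alpha>" for \<kappa>
    proof -
      have "{v \<in> V. restrict (p \<circ> \<kappa>) V v = p i} = {v \<in> V. \<kappa> v = i}" for i
        by auto (metis qp)
      then have *: "Poly_Mapping.lookup (mon (restrict (p \<circ> \<kappa>) V)) (p i)
          = Poly_Mapping.lookup (mon \<kappa>) i" for i
        by (simp add: lmon)
      show ?thesis
        unfolding poly_mapping_eq_iff fun_eq_iff ap' by (metis * pq)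
    qed
    show ?thesis
      unfolding w_eq
      by (rule sum.reindex_bij_witness[where
            i = "\<lambda>x. (restrict (q \<circ> fst x) (pverts H), restrict (q \<circ> snd x) V)" and
            j = "\<lambda>x. (restrict (p \<circ> fst x) (pverts H), restrict (p \<circ> snd x) V)"])
        (use act[OF p] act[OF q] act_inv[of _ q p] act_inv[of _ p q] qp pq monp in simp_all)
  qed
  have iff: "is_chromatic_coeff G H c \<longleftrightarrow>
      (\<forall>\<alpha>. Poly_Mapping.lookup w \<alpha> =
        (if Poly_Mapping.keys \<alpha> \<subseteq> {1..n} \<and> exponents \<alpha> \<in> P then c (exponents \<alpha>) else 0))
      \<and> (\<forall>\<mu>. \<mu> \<notin> P \<longrightarrow> c \<mu> = 0)" for c
    unfolding is_chromatic_coeff_def Let_def n_def[symmetric] k_def[symmetric]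
      P_def[symmetric] w_def[symmetric] poly_mapping_eq_iff fun_eq_iff
      lookup_monomial_sym_poly_sum[OF finP] ..
  define rep where "rep \<mu> = (SOME \<alpha>. Poly_Mapping.keys \<alpha> \<subseteq> {1..n} \<and> exponents \<alpha> = \<mu>)" for \<mu>
  have rep: "Poly_Mapping.keys (rep \<mu>) \<subseteq> {1..n} \<and> exponents (rep \<mu>) = \<mu>" if "\<mu> \<in> P" for \<mu>
    unfolding rep_def by (rule someI_ex) (use that ex_monomial_exponents P_def in blast)
  let ?c = "\<lambda>l. if l \<in> P then Poly_Mapping.lookup w (rep l) else 0"
  show ?thesis
  proof (rule ex1I[of _ ?c])
    have "Poly_Mapping.lookup w \<alpha> =
        (if Poly_Mapping.keys \<alpha> \<subseteq> {1..n} \<and> exponents \<alpha> \<in> P then ?c (exponents \<alpha>) else 0)" for \<alpha>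
    proof (cases "Poly_Mapping.keys \<alpha> \<subseteq> {1..n} \<and> exponents \<alpha> \<in> P")
      case True
      then have "Poly_Mapping.lookup w \<alpha> = Poly_Mapping.lookup w (rep (exponents \<alpha>))"
        using rep[of "exponents \<alpha>"] by (intro sym) simp_all
      with True show ?thesis by simp
    next
      case False
      with shape[of \<alpha>] have "Poly_Mapping.lookup w \<alpha> = 0" by blast
      with False show ?thesis by (simp only: if_False)
    qed
    then show "is_chromatic_coeff G H ?c"
      unfolding iff by (intro conjI allI impI) (assumption | simp)+
    fix c assume c: "is_chromatic_coeff G H c"
    show "c = ?c"
    proof
      fix l
      have c0: "l \<notin> P \<Longrightarrow> c l = 0" using c unfolding iff by blast
      have c1: "Poly_Mapping.lookup w (rep l) =
          (if Poly_Mapping.keys (rep l) \<subseteq> {1..n} \<and> exponents (rep l) \<in> P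
           then c (exponents (rep l)) else 0)"
        using c unfolding iff by blast
      show "c l = ?c l"
        using c0 c1 rep[of l] by (cases "l \<in> P") simp_all
    qed
  qed
qed

end

theory Submission
  imports Defs "HOL-Library.Nat_Bijection"
begin

text \<open>The sum of the coefficients of \<open>w\<^sub>G\<^sup>H\<close> is \<open>|V(H)|!\<close> times the number of homomorphisms
  from \<open>G\<close> to \<open>H\<close>, so it suffices that the members of the family have pairwise different
  numbers of homomorphisms into one graph \<open>H\<close>. Let \<open>B\<close> contain every member of the family as
  an induced subgraph, and let \<open>H\<close> be the blow-up of \<open>B\<close> in which the vertex \<open>b\<close> (a natural
  number) is replaced by \<open>M ^ (K ^ b)\<close> independent copies. Then \<open>G\<close> has \<open>\<Sum>\<^sub>g M ^ e(g)\<close>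
  homomorphisms to \<open>H\<close>, where \<open>g\<close> ranges over the homomorphisms from \<open>G\<close> to \<open>B\<close> and
  \<open>e(g) = \<Sum>\<^sub>v K ^ g(v)\<close>. For large \<open>M\<close> and \<open>K\<close> the digits in base \<open>M\<close> of this
  number, and then the digits in base \<open>K\<close> of the exponents, reveal how many \<open>g\<close> have
  prescribed fibre sizes. In particular they reveal whether \<open>G\<close> maps bijectively onto the copy of \<open>G'\<close> in \<open>B\<close>; bijective homomorphisms in both directions between finite
  graphs make them isomorphic.\<close>

section \<open>Uniqueness of digits and sums of powers\<close>

text \<open>Reducing modulo \<open>M\<close> isolates the lowest digit; cancelling it and dividing
  by \<open>M\<close> leaves an expansion that is one digit shorter.\<close>

lemma digits_unique:
  fixes c d :: "nat \<Rightarrow> nat"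
  assumes "\<And>i. c i < M" "\<And>i. d i < M"
    and "(\<Sum>i<N. c i * M ^ i) = (\<Sum>i<N. d i * M ^ i)" and "i < N"
  shows "c i = d i"
  using assms
proof (induction N arbitrary: c d i)
  case (Suc N)
  have split: "(\<Sum>i<Suc N. f i * M ^ i) = f 0 + M * (\<Sum>i<N. f (Suc i) * M ^ i)"
    for f :: "nat \<Rightarrow> nat"
    by (simp only: sum.lessThan_Suc_shift) (simp add: sum_distrib_left mult_ac)
  have eq: "c 0 + M * (\<Sum>i<N. c (Suc i) * M ^ i) = d 0 + M * (\<Sum>i<N. d (Suc i) * M ^ i)"
    using Suc.prems(3) unfolding split .
  have M: "M > 0" using Suc.prems(1)[of 0] by simp
  have c0: "c 0 = d 0"
    using arg_cong[OF eq, of "\<lambda>x. x mod M"] Suc.prems(1,2) by simp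
  have *: "(\<Sum>i<N. c (Suc i) * M ^ i) = (\<Sum>i<N. d (Suc i) * M ^ i)"
    using eq c0 M by simp
  show ?case
  proof (cases i)
    case 0
    then show ?thesis using c0 by simp
  next
    case (Suc j)
    then show ?thesis
      using Suc.IH[of "\<lambda>i. c (Suc i)" "\<lambda>i. d (Suc i)" j] Suc.prems * by simp
  qed
qed simp

text \<open>Grouping equal exponents turns each sum into a base-\<open>M\<close> expansion whose
  digits are the fibre sizes; the bounds on the cardinalities exclude carries. The lemma serves
  twice: in base \<open>M\<close> for homomorphisms and in base \<open>K\<close> for
  vertices.\<close>

lemma card_fibre_eq_if_sum_power_eq:
  fixes M :: nat and e :: "'a \<Rightarrow> nat" and e' :: "'b \<Rightarrow> nat"
  assumes fin: "finite A" "finite B" and less: "card A < M" "card B < M"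
    and eq: "(\<Sum>a\<in>A. M ^ e a) = (\<Sum>b\<in>B. M ^ e' b)"
  shows "card {a \<in> A. e a = i} = card {b \<in> B. e' b = i}"
proof -
  \<comment> \<open>Inserting \<open>i\<close> keeps its digit within the expansion even when
    neither function attains the value \<open>i\<close>.\<close>
  obtain N where "\<forall>n \<in> insert i (e ` A \<union> e' ` B). n < N"
    using finite_nat_set_iff_bounded[of "insert i (e ` A \<union> e' ` B)"] fin by blast
  then have N: "e ` A \<subseteq> {..<N}" "e' ` B \<subseteq> {..<N}" "i < N" by auto
  have "(\<Sum>i<N. card {a \<in> A. e a = i} * M ^ i) = (\<Sum>i<N. card {b \<in> B. e' b = i} * M ^ i)"
    using sum.group[OF fin(1) _ N(1), of "\<lambda>a. M ^ e a"]
      sum.group[OF fin(2) _ N(2), of "\<lambda>b. M ^ e' b"] eq by simp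
  moreover have "card {a \<in> A. e a = i} < M" "card {b \<in> B. e' b = i} < M" for i
    using fin less card_mono[of A "{a \<in> A. e a = i}"] card_mono[of B "{b \<in> B. e' b = i}"]
    by fastforce+
  ultimately show ?thesis
    using N(3) digits_unique[of "\<lambda>i. card {a \<in> A. e a = i}" M "\<lambda>i. card {b \<in> B. e' b = i}" N i]
    by blast
qed

section \<open>Homomorphisms and isomorphism\<close>

definition homs :: "'a pair_pre_digraph \<Rightarrow> 'b pair_pre_digraph \<Rightarrow> ('a \<Rightarrow> 'b) set" where
  "homs G H = {f \<in> pverts G \<rightarrow>\<^sub>E pverts H. \<forall>u v. (u, v) \<in> parcs G \<longrightarrow> (f u, f v) \<in> parcs H}"

lemma finite_homs:
  assumes "finite (pverts G)" "finite (pverts H)"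
  shows "finite (homs G H)"
  by (rule finite_subset[of _ "pverts G \<rightarrow>\<^sub>E pverts H"])
    (auto simp: homs_def assms intro!: finite_PiE)

lemma inj_on_map_prod_parcs:
  assumes "pair_wf_digraph G" "inj_on f (pverts G)"
  shows "inj_on (map_prod f f) (parcs G)"
proof (rule inj_on_subset)
  interpret G: pair_wf_digraph G by fact
  show "inj_on (map_prod f f) (pverts G \<times> pverts G)" using assms(2) by (intro map_prod_inj_on)
  show "parcs G \<subseteq> pverts G \<times> pverts G" by (auto simp: G.in_arcsD1 G.in_arcsD2)
qed

lemma graph_isomorphicI:
  assumes "pair_wf_digraph G" and f: "bij_betw f (pverts G) (pverts H)"
    and arcs: "parcs H = map_prod f f ` parcs G"
  shows "graph_isomorphic G H"
proof -
  interpret G: pair_wf_digraph G by fact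
  let ?hom = "\<lparr> iso_verts = f, iso_arcs = map_prod f f, iso_head = snd, iso_tail = fst \<rparr>"
  have "inj_on (map_prod f f) (parcs G)"
    using f assms(1) by (auto intro: inj_on_map_prod_parcs simp: bij_betw_def)
  then have "G.digraph_isomorphism ?hom"
    using f G.wf_digraph_axioms by (auto simp: G.digraph_isomorphism_def bij_betw_def)
  moreover have "with_proj H = app_iso ?hom (with_proj G)"
    using f arcs by (intro pre_digraph.equality) (auto simp: bij_betw_def)
  ultimately show ?thesis
    unfolding graph_isomorphic_def digraph_iso_def by blast
qed

text \<open>A bijective homomorphism may miss arcs of its target. Having one in each direction
  forces equally many arcs on both sides, so by finiteness \<open>f\<close> is onto the arcs as
  well.\<close>

lemma graph_isomorphic_if_bij_homs:
  assumes "pair_graph G" "pair_graph H"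
    and f: "f \<in> homs G H" "bij_betw f (pverts G) (pverts H)"
    and g: "g \<in> homs H G" "bij_betw g (pverts H) (pverts G)"
  shows "graph_isomorphic G H"
proof -
  \<comment> \<open>Fresh type variables allow this to be used for \<open>f\<close> and for
    \<open>g\<close>.\<close>
  have card_le: "map_prod f f ` parcs G \<subseteq> parcs H \<and> card (map_prod f f ` parcs G) = card (parcs G)"
    if "pair_graph G" "f \<in> homs G H" "bij_betw f (pverts G) (pverts H)"
    for G :: "'c pair_pre_digraph" and H :: "'d pair_pre_digraph" and f
  proof -
    interpret G: pair_graph G by fact
    have "inj_on (map_prod f f) (parcs G)"
      using that(3) G.pair_wf_digraph by (auto intro: inj_on_map_prod_parcs simp: bij_betw_def)
    then show ?thesis using that by (auto simp: homs_def card_image)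
  qed
  interpret G: pair_graph G by fact
  interpret H: pair_graph H by fact
  note fG = card_le[OF assms(1) f] and gH = card_le[OF assms(2) g]
  have "card (parcs H) \<le> card (parcs G)"
    using gH card_mono[OF G.pair_finite_arcs, of "map_prod g g ` parcs H"] by simp
  then have "parcs H = map_prod f f ` parcs G"
    using fG H.pair_finite_arcs by (metis card_seteq)
  with f(2) show ?thesis
    by (intro graph_isomorphicI[of G f]) (unfold_locales)
qed

section \<open>Blow-ups and their homomorphism counts\<close>

text \<open>The copies of \<open>b\<close> are the pairs \<open>(b, i)\<close>, encoded as naturals
  because the distinguishing graph has to live on that type. Adjacency ignores the copy index, so
  copies of one vertex are not adjacent when \<open>B\<close> has no loops.\<close>

definition blow_up :: "nat pair_pre_digraph \<Rightarrow> (nat \<Rightarrow> nat) \<Rightarrow> nat pair_pre_digraph" where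
  "blow_up B t = (let V = prod_encode ` (SIGMA b:pverts B. {..<t b}) in
     \<lparr> pverts = V,
       parcs = {(x, y) \<in> V \<times> V. (fst (prod_decode x), fst (prod_decode y)) \<in> parcs B} \<rparr>)"

lemma pverts_blow_up: "pverts (blow_up B t) = prod_encode ` (SIGMA b:pverts B. {..<t b})"
  by (simp add: blow_up_def Let_def)

lemma in_parcs_blow_up_iff:
  "(x, y) \<in> parcs (blow_up B t) \<longleftrightarrow> x \<in> pverts (blow_up B t) \<and> y \<in> pverts (blow_up B t)
     \<and> (fst (prod_decode x), fst (prod_decode y)) \<in> parcs B"
  by (auto simp: blow_up_def Let_def)

lemma pair_graph_blow_up:
  assumes "pair_graph B"
  shows "pair_graph (blow_up B t)"
proof -
  interpret B: pair_graph B by fact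
  let ?H = "blow_up B t"
  have fin: "finite (pverts ?H)" by (auto simp: pverts_blow_up)
  have sub: "parcs ?H \<subseteq> pverts ?H \<times> pverts ?H" by (auto simp: in_parcs_blow_up_iff)
  show ?thesis
  proof unfold_locales
    show "finite (parcs ?H)" using fin sub by (meson finite_SigmaI finite_subset)
    show "symmetric (with_proj ?H)"
      using B.pair_sym_arcs
      by (auto simp: symmetric_def in_parcs_blow_up_iff intro!: symI dest: symD)
    show "fst e \<noteq> snd e" if "e \<in> parcs ?H" for e
      using that B.pair_no_loops by (cases e) (force simp: in_parcs_blow_up_iff)
  qed (use fin sub in auto)
qed

text \<open>Forgetting the copy index maps homomorphisms into the blow-up to homomorphisms
  \<open>g\<close> into \<open>B\<close>. Conversely, every choice of a copy of \<open>g v\<close>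
  for each \<open>v\<close> lifts \<open>g\<close>, since adjacency depends on the projections
  only.\<close>

lemma card_homs_blow_up:
  assumes "pair_graph G" "pair_graph B"
  shows "card (homs G (blow_up B t)) = (\<Sum>g\<in>homs G B. \<Prod>v\<in>pverts G. t (g v))"
proof -
  interpret G: pair_graph G by fact
  interpret B: pair_graph B by fact
  interpret H: pair_graph "blow_up B t" by (rule pair_graph_blow_up) fact
  let ?H = "blow_up B t" and ?V = "pverts G"
  define p where "p f = restrict (\<lambda>v. fst (prod_decode (f v))) ?V" for f :: "'a \<Rightarrow> nat"
  have p: "p ` homs G ?H \<subseteq> homs G B"
  proof clarify
    fix f assume f: "f \<in> homs G ?H"
    have "fst (prod_decode (f v)) \<in> pverts B" if "v \<in> ?V" for v
    proof -
      have "f v \<in> pverts ?H" using f that by (auto simp: homs_def)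
      then show ?thesis by (auto simp: pverts_blow_up)
    qed
    then show "p f \<in> homs G B"
      using f by (auto simp: p_def homs_def in_parcs_blow_up_iff G.in_arcsD1 G.in_arcsD2)
  qed
  have fibre: "{f \<in> homs G ?H. p f = g} = (\<Pi>\<^sub>E v\<in>?V. prod_encode ` ({g v} \<times> {..<t (g v)}))"
    (is "?L = ?R") if g: "g \<in> homs G B" for g
  proof (intro equalityI subsetI)
    fix f assume f: "f \<in> ?L"
    have "f v \<in> prod_encode ` ({g v} \<times> {..<t (g v)})" if v: "v \<in> ?V" for v
    proof -
      have "f v \<in> pverts ?H" using f v by (auto simp: homs_def)
      moreover have "fst (prod_decode (f v)) = g v" using f v by (auto simp: p_def)
      ultimately show ?thesis by (auto simp: pverts_blow_up)
    qed
    then show "f \<in> ?R" using f by (auto simp: homs_def PiE_iff)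
  next
    fix f assume f: "f \<in> ?R"
    have fv: "f v \<in> pverts ?H" "fst (prod_decode (f v)) = g v" if v: "v \<in> ?V" for v
    proof -
      have "g v \<in> pverts B" using g v by (auto simp: homs_def)
      moreover have "f v \<in> prod_encode ` ({g v} \<times> {..<t (g v)})" using f v by (rule PiE_mem)
      ultimately show "f v \<in> pverts ?H" "fst (prod_decode (f v)) = g v"
        by (auto simp: pverts_blow_up)
    qed
    have "p f v = g v" for v
      using fv g by (cases "v \<in> ?V") (auto simp: p_def homs_def PiE_iff extensional_def)
    moreover have "f \<in> homs G ?H"
      using fv f g by (auto simp: homs_def PiE_iff in_parcs_blow_up_iff G.in_arcsD1 G.in_arcsD2)
    ultimately show "f \<in> ?L" by auto
  qed
  have card_img: "card (prod_encode ` ({b} \<times> {..<n})) = n" for b n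
    by (subst card_image) (auto simp: card_cartesian_product inj_prod_encode)
  have "card (homs G ?H) = (\<Sum>g\<in>homs G B. card {f \<in> homs G ?H. p f = g})"
    using sum.group[OF _ _ p, of "\<lambda>_. 1::nat"] by (simp add: finite_homs)
  also have "\<dots> = (\<Sum>g\<in>homs G B. \<Prod>v\<in>?V. t (g v))"
    by (rule sum.cong) (simp_all add: fibre card_PiE card_img)
  finally show ?thesis .
qed

section \<open>A common induced supergraph\<close>

text \<open>The disjoint union works: vertices are tagged with their graph, since members of the
  family may share vertices, and then numbered injectively by \<open>h\<close>.\<close>

lemma ex_common_induced_supergraph:
  fixes \<G> :: "'a pair_pre_digraph set"
  assumes "finite \<G>" "\<And>G. G \<in> \<G> \<Longrightarrow> pair_graph G"
  obtains B :: "nat pair_pre_digraph" and \<iota> :: "'a pair_pre_digraph \<Rightarrow> 'a \<Rightarrow> nat"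
  where "pair_graph B"
    and "\<And>G. G \<in> \<G> \<Longrightarrow> inj_on (\<iota> G) (pverts G)"
    and "\<And>G v. G \<in> \<G> \<Longrightarrow> v \<in> pverts G \<Longrightarrow> \<iota> G v \<in> pverts B"
    and "\<And>G u v. G \<in> \<G> \<Longrightarrow> u \<in> pverts G \<Longrightarrow> v \<in> pverts G \<Longrightarrow>
      (\<iota> G u, \<iota> G v) \<in> parcs B \<longleftrightarrow> (u, v) \<in> parcs G"
proof -
  define W where "W = (SIGMA G:\<G>. pverts G)"
  have "finite W"
    unfolding W_def using assms by (auto intro: pair_fin_digraph.pair_finite_verts
        simp: pair_graph_def pair_digraph_def)
  then obtain h :: "'a pair_pre_digraph \<times> 'a \<Rightarrow> nat" where h: "inj_on h W"
    using finite_imp_inj_to_nat_seg by metis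
  define B where "B = \<lparr> pverts = h ` W,
    parcs = {(h (G, u), h (G, v)) | G u v. G \<in> \<G> \<and> (u, v) \<in> parcs G} \<rparr>"
  have wf: "u \<in> pverts G" "v \<in> pverts G" if "G \<in> \<G>" "(u, v) \<in> parcs G" for G u v
  proof -
    interpret pair_graph G using assms that by blast
    show "u \<in> pverts G" "v \<in> pverts G" using that by (auto simp: in_arcsD1 in_arcsD2)
  qed
  have arcs: "(h (G, u), h (G, v)) \<in> parcs B \<longleftrightarrow> (u, v) \<in> parcs G"
    if "G \<in> \<G>" "u \<in> pverts G" "v \<in> pverts G" for G u v
  proof
    \<comment> \<open>The arc might come from another member \<open>G'\<close>; injectivity of
      \<open>h\<close> on tagged vertices forces \<open>G' = G\<close>.\<close>
    assume "(h (G, u), h (G, v)) \<in> parcs B"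
    then obtain G' u' v' where *: "h (G, u) = h (G', u')" "h (G, v) = h (G', v')"
      "G' \<in> \<G>" "(u', v') \<in> parcs G'"
      by (auto simp: B_def)
    moreover have "(G, u) \<in> W" "(G, v) \<in> W" "(G', u') \<in> W" "(G', v') \<in> W"
      using that wf[OF *(3,4)] *(3) by (auto simp: W_def)
    ultimately have "(G, u) = (G', u')" "(G, v) = (G', v')"
      using h by (metis inj_onD)+
    with * show "(u, v) \<in> parcs G" by simp
  qed (use that in \<open>auto simp: B_def\<close>)
  have sub: "parcs B \<subseteq> pverts B \<times> pverts B"
    using wf by (fastforce simp: B_def W_def)
  have fin: "finite (pverts B)" using \<open>finite W\<close> by (simp add: B_def)
  have "pair_graph B"
  proof unfold_locales
    show "finite (parcs B)" using fin sub by (meson finite_SigmaI finite_subset)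
    have "(y, x) \<in> parcs B" if xy: "(x, y) \<in> parcs B" for x y
    proof -
      obtain G u v where *: "x = h (G, u)" "y = h (G, v)" "G \<in> \<G>" "(u, v) \<in> parcs G"
        using xy by (auto simp: B_def)
      interpret pair_graph G using assms * by blast
      have "(v, u) \<in> parcs G" using pair_sym_arcs *(4) by (auto simp: symmetric_def dest: symD)
      then show ?thesis using * by (auto simp: B_def)
    qed
    then show "symmetric (with_proj B)" by (auto simp: symmetric_def intro!: symI)
    show "fst e \<noteq> snd e" if e: "e \<in> parcs B" for e
    proof -
      obtain G u v where *: "e = (h (G, u), h (G, v))" "G \<in> \<G>" "(u, v) \<in> parcs G"
        using e by (auto simp: B_def)
      interpret pair_graph G using assms * by blast
      have "u \<noteq> v" using *(3) no_loops' by blast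
      then show ?thesis using * wf[OF *(2,3)] inj_onD[OF h, of "(G, u)" "(G, v)"]
        by (auto simp: W_def)
    qed
  qed (use fin sub in auto)
  moreover have "inj_on (\<lambda>v. h (G, v)) (pverts G)" if "G \<in> \<G>" for G
    using that by (auto intro!: inj_onI dest!: inj_onD[OF h] simp: W_def)
  moreover have "h (G, v) \<in> pverts B" if "G \<in> \<G>" "v \<in> pverts G" for G v
    using that by (auto simp: B_def W_def)
  ultimately show thesis using that[of B "\<lambda>G v. h (G, v)"] arcs by blast
qed

section \<open>From symmetric functions to homomorphism counts\<close>

lemma finite_labelings:
  assumes "finite (pverts H)"
  shows "finite (labelings H)"
  by (rule finite_subset[of _ "pverts H \<rightarrow>\<^sub>E {1..card (pverts H)}"])
    (auto simp: labelings_def assms intro!: finite_PiE)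

text \<open>Composing with the inverse of \<open>\<phi>\<close> turns colors into vertices of
  \<open>H\<close> and proper colorings into homomorphisms, so the count is the same for every
  labeling.\<close>

lemma card_proper_colorings:
  assumes "pair_graph G" and \<phi>: "\<phi> \<in> labelings H"
  shows "card (proper_colorings G H \<phi>) = card (homs G H)"
proof -
  interpret G: pair_graph G by fact
  let ?n = "card (pverts H)" and ?\<psi> = "the_inv_into (pverts H) \<phi>"
  have b: "bij_betw \<phi> (pverts H) {1..?n}" using \<phi> by (simp add: labelings_def)
  have b': "bij_betw ?\<psi> {1..?n} (pverts H)" by (rule bij_betw_the_inv_into[OF b])
  have inv1: "?\<psi> (\<phi> x) = x" if "x \<in> pverts H" for x
    using that b by (simp add: the_inv_into_f_f bij_betw_def)
  have inv2: "\<phi> (?\<psi> i) = i" if "i \<in> {1..?n}" for i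
    using that b by (simp add: f_the_inv_into_f_bij_betw)
  show ?thesis
  proof (rule bij_betw_same_card[OF bij_betw_byWitness[where
          f = "\<lambda>\<kappa>. restrict (?\<psi> \<circ> \<kappa>) (pverts G)" and f' = "\<lambda>f. restrict (\<phi> \<circ> f) (pverts G)"]])
    show "\<forall>\<kappa>\<in>proper_colorings G H \<phi>.
        restrict (\<phi> \<circ> restrict (?\<psi> \<circ> \<kappa>) (pverts G)) (pverts G) = \<kappa>"
    proof
      fix \<kappa> assume "\<kappa> \<in> proper_colorings G H \<phi>"
      then have "\<kappa> \<in> pverts G \<rightarrow>\<^sub>E {1..?n}" by (simp add: proper_colorings_def)
      then show "restrict (\<phi> \<circ> restrict (?\<psi> \<circ> \<kappa>) (pverts G)) (pverts G) = \<kappa>"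
        by (intro extensionalityI[of _ "pverts G"]) (auto simp: PiE_iff inv2)
    qed
    show "\<forall>f\<in>homs G H. restrict (?\<psi> \<circ> restrict (\<phi> \<circ> f) (pverts G)) (pverts G) = f"
    proof
      fix f assume "f \<in> homs G H"
      then have "f \<in> pverts G \<rightarrow>\<^sub>E pverts H" by (simp add: homs_def)
      then show "restrict (?\<psi> \<circ> restrict (\<phi> \<circ> f) (pverts G)) (pverts G) = f"
        by (intro extensionalityI[of _ "pverts G"]) (auto simp: PiE_iff inv1)
    qed
    show "(\<lambda>\<kappa>. restrict (?\<psi> \<circ> \<kappa>) (pverts G)) ` proper_colorings G H \<phi> \<subseteq> homs G H"
      using bij_betwE[OF b']
      by (auto simp: proper_colorings_def homs_def G.in_arcsD1 G.in_arcsD2 PiE_iff)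
    show "(\<lambda>f. restrict (\<phi> \<circ> f) (pverts G)) ` homs G H \<subseteq> proper_colorings G H \<phi>"
    proof clarify
      fix f assume f: "f \<in> homs G H"
      then have fv: "f v \<in> pverts H" if "v \<in> pverts G" for v using that by (auto simp: homs_def)
      have "restrict (\<phi> \<circ> f) (pverts G) \<in> pverts G \<rightarrow>\<^sub>E {1..?n}"
        using fv bij_betwE[OF b] by auto
      then show "restrict (\<phi> \<circ> f) (pverts G) \<in> proper_colorings G H \<phi>"
        using f fv by (auto simp: proper_colorings_def homs_def G.in_arcsD1 G.in_arcsD2 inv1)
    qed
  qed
qed

text \<open>On monomials in the first \<open>card (pverts H)\<close> variables, monomial symmetric
  functions and polynomials have the same coefficients. Hence, for fixed \<open>H\<close>, the
  symmetric function determines the polynomial.\<close>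

lemma lookup_chromatic_poly_eq_chromatic_sym_fun:
  assumes "simple_graph G" "simple_graph H"
  shows "Poly_Mapping.lookup (chromatic_poly G H) \<alpha>
    = (if Poly_Mapping.keys \<alpha> \<subseteq> {1..card (pverts H)} then chromatic_sym_fun G H \<alpha> else 0)"
proof -
  let ?n = "card (pverts H)"
  let ?P = "partitions_le (card (pverts G)) ?n" and ?c = "chromatic_coeff G H"
  have "is_chromatic_coeff G H ?c"
    unfolding chromatic_coeff_def by (rule theI'[OF ex1_chromatic_coeff[OF assms]])
  then have w: "chromatic_poly G H = (\<Sum>\<mu>\<in>?P. const (?c \<mu>) * monomial_sym_poly ?n \<mu>)"
    by (simp add: is_chromatic_coeff_def Let_def)
  have "chromatic_sym_fun G H \<alpha> = (\<Sum>\<mu>\<in>?P. if exponents \<alpha> = \<mu>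
      then (if Poly_Mapping.keys \<alpha> \<subseteq> {1..} then ?c \<mu> else 0) else 0)"
    unfolding chromatic_sym_fun_def monomial_sym_fun_def by (intro sum.cong) auto
  also have "\<dots> = (if Poly_Mapping.keys \<alpha> \<subseteq> {1..} \<and> exponents \<alpha> \<in> ?P then ?c (exponents \<alpha>) else 0)"
    by (simp add: finite_partitions_le)
  finally have X: "chromatic_sym_fun G H \<alpha> = \<dots>" .
  have "Poly_Mapping.keys \<alpha> \<subseteq> {1..}" if "Poly_Mapping.keys \<alpha> \<subseteq> {1..?n}"
    using that by auto
  then show ?thesis
    unfolding w lookup_monomial_sym_poly_sum[OF finite_partitions_le] X by auto
qed

text \<open>This is the evaluation at all variables equal to 1: every pair of a labeling and a
  proper coloring contributes 1.\<close>

lemma sum_lookup_chromatic_poly: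
  assumes G: "pair_graph G" and H: "pair_graph H"
    and T: "finite T" "Poly_Mapping.keys (chromatic_poly G H) \<subseteq> T"
  shows "(\<Sum>\<alpha>\<in>T. Poly_Mapping.lookup (chromatic_poly G H) \<alpha>)
    = int (card (labelings H) * card (homs G H))"
proof -
  interpret G: pair_graph G by fact
  interpret H: pair_graph H by fact
  let ?C = "proper_colorings G H" and ?w = "chromatic_poly G H"
  define mon where "mon \<kappa> = (\<Sum>v\<in>pverts G. Poly_Mapping.single (\<kappa> v) (1::nat))"
    for \<kappa> :: "'a \<Rightarrow> nat"
  have finL: "finite (labelings H)" by (rule finite_labelings) simp
  have finC: "finite (?C \<phi>)" for \<phi>
    by (rule finite_subset[of _ "pverts G \<rightarrow>\<^sub>E {1..card (pverts H)}"])
      (auto simp: proper_colorings_def intro!: finite_PiE)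
  \<comment> \<open>Adding the monomials of all colorings makes each coloring count exactly once in
    the sum over \<open>U\<close>; the monomials outside \<open>T\<close> have coefficient
    0.\<close>
  define U where "U = T \<union> (\<Union>\<phi>\<in>labelings H. mon ` ?C \<phi>)"
  have finU: "finite U" using T finL finC by (auto simp: U_def)
  have w: "Poly_Mapping.lookup ?w \<alpha> = (\<Sum>\<phi>\<in>labelings H. \<Sum>\<kappa>\<in>?C \<phi>. if mon \<kappa> = \<alpha> then 1 else 0)"
    for \<alpha>
    unfolding chromatic_poly_def
    by (simp add: lookup_sum prod_var mon_def lookup_single when_def eq_commute)
  have "(\<Sum>\<alpha>\<in>T. Poly_Mapping.lookup ?w \<alpha>) = (\<Sum>\<alpha>\<in>U. Poly_Mapping.lookup ?w \<alpha>)"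
    using T finU by (intro sum.mono_neutral_left) (auto simp: U_def in_keys_iff)
  also have "\<dots> = (\<Sum>\<phi>\<in>labelings H. \<Sum>\<alpha>\<in>U. \<Sum>\<kappa>\<in>?C \<phi>. if mon \<kappa> = \<alpha> then 1 else 0)"
    unfolding w by (rule sum.swap)
  also have "\<dots> = (\<Sum>\<phi>\<in>labelings H. \<Sum>\<kappa>\<in>?C \<phi>. \<Sum>\<alpha>\<in>U. if mon \<kappa> = \<alpha> then 1 else 0)"
    by (intro sum.cong refl sum.swap)
  also have "\<dots> = (\<Sum>\<phi>\<in>labelings H. \<Sum>\<kappa>\<in>?C \<phi>. 1)"
    using finU by (intro sum.cong refl) (auto simp: U_def)
  also have "\<dots> = (\<Sum>\<phi>\<in>labelings H. int (card (homs G H)))"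
    by (intro sum.cong refl) (simp add: card_proper_colorings[OF G])
  finally show ?thesis by simp
qed

lemma card_homs_eq_if_chromatic_sym_fun_eq:
  assumes "simple_graph G\<^sub>1" "simple_graph G\<^sub>2" "simple_graph H"
    and "chromatic_sym_fun G\<^sub>1 H = chromatic_sym_fun G\<^sub>2 H"
  shows "card (homs G\<^sub>1 H) = card (homs G\<^sub>2 H)"
proof -
  interpret H: pair_graph H using assms by (simp add: simple_graph_def)
  have w: "chromatic_poly G\<^sub>1 H = chromatic_poly G\<^sub>2 H"
    by (rule poly_mapping_eqI)
      (simp add: lookup_chromatic_poly_eq_chromatic_sym_fun assms)
  have "card (labelings H) * card (homs G\<^sub>1 H) = card (labelings H) * card (homs G\<^sub>2 H)"
    using sum_lookup_chromatic_poly[of G\<^sub>1 H, OF _ _ finite_keys order_refl]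
      sum_lookup_chromatic_poly[of G\<^sub>2 H, OF _ _ finite_keys order_refl] assms w
    unfolding simple_graph_def by (metis of_nat_eq_iff)
  \<comment> \<open>At least one labeling is needed to cancel the common factor.\<close>
  moreover have "card (labelings H) \<noteq> 0"
  proof -
    obtain h where h: "bij_betw h (pverts H) {1..card (pverts H)}"
      using finite_same_card_bij[of "pverts H" "{1..card (pverts H)}"] by auto
    then have "restrict h (pverts H) \<in> labelings H"
      using bij_betwE[OF h] by (auto simp: labelings_def cong: bij_betw_cong)
    moreover have "finite (labelings H)" by (rule finite_labelings) simp
    ultimately show ?thesis by auto
  qed
  ultimately show ?thesis by simp
qed

section \<open>Bijective homomorphisms from fibre sizes\<close>

text \<open>Fibre sizes determine both injectivity and image, so \<open>g\<close> is a bijection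
  onto the copy of \<open>G'\<close> in \<open>B\<close>. Following it by the inverse of
  \<open>\<iota>\<close> gives \<open>f\<close>; arcs survive because the copy is induced.\<close>

lemma bij_hom_if_fibres_eq:
  assumes "pair_graph G" "pair_graph G'"
    and g: "g \<in> homs G B"
    and inj: "inj_on \<iota> (pverts G')"
    and arcs: "\<And>u v. u \<in> pverts G' \<Longrightarrow> v \<in> pverts G' \<Longrightarrow> (\<iota> u, \<iota> v) \<in> parcs B \<Longrightarrow> (u, v) \<in> parcs G'"
    and fibre: "\<And>i. card {v \<in> pverts G. g v = i} = card {v \<in> pverts G'. \<iota> v = i}"
  obtains f where "f \<in> homs G G'" "bij_betw f (pverts G) (pverts G')"
proof -
  interpret G: pair_graph G by fact
  interpret G': pair_graph G' by fact
  have le: "card {v \<in> pverts G'. \<iota> v = i} \<le> 1" for i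
    using inj by (auto simp: card_le_Suc0_iff_eq inj_on_def)
  have "inj_on g (pverts G)"
  proof (rule inj_onI)
    fix u v assume uv: "u \<in> pverts G" "v \<in> pverts G" "g u = g v"
    then have "{u, v} \<subseteq> {x \<in> pverts G. g x = g u}" by auto
    then have "card {u, v} \<le> 1"
      using card_mono[of "{x \<in> pverts G. g x = g u}" "{u, v}"] fibre[of "g u"] le[of "g u"] by simp
    then show "u = v" by (cases "u = v") auto
  qed
  moreover have "g ` pverts G = \<iota> ` pverts G'"
  proof -
    have "i \<in> g ` pverts G \<longleftrightarrow> card {v \<in> pverts G. g v = i} \<noteq> 0" for i by auto
    moreover have "i \<in> \<iota> ` pverts G' \<longleftrightarrow> card {v \<in> pverts G'. \<iota> v = i} \<noteq> 0" for i by auto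
    ultimately show ?thesis using fibre by (intro set_eqI) (simp only:)
  qed
  ultimately have bg: "bij_betw g (pverts G) (\<iota> ` pverts G')" by (simp add: bij_betw_def)
  define j where "j = the_inv_into (pverts G') \<iota>"
  have bj: "bij_betw j (\<iota> ` pverts G') (pverts G')"
    unfolding j_def using inj by (intro bij_betw_the_inv_into) (simp add: bij_betw_def)
  have \<iota>j: "\<iota> (j i) = i" if "i \<in> \<iota> ` pverts G'" for i
    using that inj by (simp add: j_def f_the_inv_into_f)
  let ?f = "restrict (j \<circ> g) (pverts G)"
  have bf: "bij_betw ?f (pverts G) (pverts G')"
    using bij_betw_trans[OF bg bj] by (simp cong: bij_betw_cong)
  have "(?f u, ?f v) \<in> parcs G'" if uv: "(u, v) \<in> parcs G" for u v
  proof -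
    have m: "u \<in> pverts G" "v \<in> pverts G" using uv by (auto simp: G.in_arcsD1 G.in_arcsD2)
    then have "\<iota> (?f u) = g u" "\<iota> (?f v) = g v" using bij_betwE[OF bg] \<iota>j by auto
    moreover have "(g u, g v) \<in> parcs B" using g uv by (auto simp: homs_def)
    moreover have "?f u \<in> pverts G'" "?f v \<in> pverts G'" using bij_betwE[OF bf] m by blast+
    ultimately show ?thesis using arcs[of "?f u" "?f v"] by simp
  qed
  then have "?f \<in> homs G G'" using bij_betwE[OF bf] by (auto simp: homs_def)
  with bf show thesis using that by blast
qed

section \<open>The distinguishing graph\<close>

theorem proposition4p7:
  fixes \<G> :: "'a pair_pre_digraph set"
  assumes "finite \<G>"
    and "\<forall>G\<in>\<G>. simple_graph G"
    and "\<forall>G\<^sub>1\<in>\<G>. \<forall>G\<^sub>2\<in>\<G>. G\<^sub>1 \<noteq> G\<^sub>2 \<longrightarrow> \<not> graph_isomorphic G\<^sub>1 G\<^sub>2"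
  shows "uniformly_distinguishable \<G>"
proof (cases "\<G> = {}")
  case True
  \<comment> \<open>Even the empty family requires a graph with a vertex, which the blow-up
    construction would not provide here.\<close>
  have "distinguisher \<G> {\<lparr> pverts = {0::nat}, parcs = {} \<rparr>}"
    unfolding distinguisher_def simple_graph_def True
    by (auto simp: symmetric_def sym_def) (unfold_locales, auto simp: symmetric_def sym_def)
  then show ?thesis unfolding uniformly_distinguishable_def by (intro exI conjI) auto
next
  case False
  have gr: "pair_graph G" if "G \<in> \<G>" for G using assms(2) that by (simp add: simple_graph_def)
  obtain B :: "nat pair_pre_digraph" and \<iota> :: "'a pair_pre_digraph \<Rightarrow> 'a \<Rightarrow> nat" where
    B: "pair_graph B"
    and inj: "\<And>G. G \<in> \<G> \<Longrightarrow> inj_on (\<iota> G) (pverts G)"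
    and verts: "\<And>G v. G \<in> \<G> \<Longrightarrow> v \<in> pverts G \<Longrightarrow> \<iota> G v \<in> pverts B"
    and arcs: "\<And>G u v. G \<in> \<G> \<Longrightarrow> u \<in> pverts G \<Longrightarrow> v \<in> pverts G \<Longrightarrow>
      (\<iota> G u, \<iota> G v) \<in> parcs B \<longleftrightarrow> (u, v) \<in> parcs G"
    by (rule ex_common_induced_supergraph[OF assms(1) gr]) blast+
  interpret B: pair_graph B by fact
  \<comment> \<open>\<open>K\<close> exceeds all vertex counts and \<open>M\<close> all numbers of
    homomorphisms into \<open>B\<close>, so that fibre sizes are proper digits in these
    bases.\<close>
  define K where "K = Suc (\<Sum>G\<in>\<G>. card (pverts G))"
  define M where "M = Suc (\<Sum>G\<in>\<G>. card (homs G B))"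
  define H where "H = blow_up B (\<lambda>b. M ^ (K ^ b))"
  have K: "card (pverts G) < K" if "G \<in> \<G>" for G
    using that assms(1) by (auto simp: K_def less_Suc_eq_le intro!: member_le_sum)
  have M: "card (homs G B) < M" if "G \<in> \<G>" for G
    using that assms(1)
    by (auto simp: M_def less_Suc_eq_le intro!: member_le_sum[of G \<G> "\<lambda>G. card (homs G B)"])
  have fin: "finite (pverts G)" if "G \<in> \<G>" for G
    using gr[OF that] by (auto simp: pair_graph_def pair_digraph_def
        intro: pair_fin_digraph.pair_finite_verts)
  have H: "simple_graph H"
  proof -
    obtain G v where "G \<in> \<G>" "v \<in> pverts G"
      using False assms(2) by (fastforce simp: simple_graph_def)
    \<comment> \<open>Copy 0 exists because \<open>M\<close> is positive.\<close>
    then have "prod_encode (\<iota> G v, 0) \<in> pverts H"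
      using verts by (auto simp: H_def pverts_blow_up M_def)
    then show ?thesis
      using pair_graph_blow_up[OF B] by (auto simp: simple_graph_def H_def)
  qed
  \<comment> \<open>The doubly exponential multiplicities turn the product over the vertices into
    one power of \<open>M\<close>, whose exponent is a sum of powers of \<open>K\<close>.\<close>
  have count: "card (homs G H) = (\<Sum>g\<in>homs G B. M ^ (\<Sum>v\<in>pverts G. K ^ g v))"
    if "G \<in> \<G>" for G
    unfolding H_def by (simp add: card_homs_blow_up[OF gr[OF that] B] power_sum)
  have ex_bij: "\<exists>f. f \<in> homs G G' \<and> bij_betw f (pverts G) (pverts G')"
    if G: "G \<in> \<G>" "G' \<in> \<G>" and eq: "card (homs G H) = card (homs G' H)" for G G'
  proof -
    interpret G': pair_graph G' using gr G by blast
    let ?e = "\<lambda>G g. \<Sum>v\<in>pverts G. K ^ g v"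
    \<comment> \<open>The embedding of \<open>G'\<close>, made extensional to be a member of
      \<open>homs\<close>.\<close>
    define g' where "g' = restrict (\<iota> G') (pverts G')"
    have g': "g' \<in> homs G' B"
      using verts[OF G(2)] arcs[OF G(2)]
      by (auto simp: g'_def homs_def G'.in_arcsD1 G'.in_arcsD2)
    \<comment> \<open>Comparison of the base-\<open>M\<close> digits at the exponent of
      \<open>g'\<close>: this digit is nonzero for \<open>G'\<close>, so some homomorphism from
      \<open>G\<close> has the same exponent.\<close>
    have "card {g \<in> homs G B. ?e G g = ?e G' g'} = card {g \<in> homs G' B. ?e G' g = ?e G' g'}"
      using eq G count[OF G(1)] count[OF G(2)]
      by (intro card_fibre_eq_if_sum_power_eq[of _ _ M]) (auto intro!: finite_homs fin M)
    moreover have "finite (homs G' B)" using fin G by (intro finite_homs) auto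
    then have "card {g \<in> homs G' B. ?e G' g = ?e G' g'} \<noteq> 0" using g' by auto
    ultimately have "{g \<in> homs G B. ?e G g = ?e G' g'} \<noteq> {}" by (metis card.empty)
    then obtain g where g: "g \<in> homs G B" "?e G g = ?e G' g'" by blast
    have "?e G' g' = ?e G' (\<iota> G')" by (rule sum.cong) (auto simp: g'_def)
    \<comment> \<open>Equal exponents have equal base-\<open>K\<close> digits, which are the fibre
      sizes.\<close>
    then have "card {v \<in> pverts G. g v = i} = card {v \<in> pverts G'. \<iota> G' v = i}" for i
      using g(2) G fin K by (intro card_fibre_eq_if_sum_power_eq[of _ _ K]) auto
    then show ?thesis
      using bij_hom_if_fibres_eq[OF gr[OF G(1)] gr[OF G(2)] g(1) inj[OF G(2)]] arcs[OF G(2)]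
      by metis
  qed
  have "distinguisher \<G> {H}"
  proof -
    have "chromatic_sym_fun G\<^sub>1 H \<noteq> chromatic_sym_fun G\<^sub>2 H"
      if G: "G\<^sub>1 \<in> \<G>" "G\<^sub>2 \<in> \<G>" "G\<^sub>1 \<noteq> G\<^sub>2" for G\<^sub>1 G\<^sub>2
    proof
      assume "chromatic_sym_fun G\<^sub>1 H = chromatic_sym_fun G\<^sub>2 H"
      then have "card (homs G\<^sub>1 H) = card (homs G\<^sub>2 H)"
        using card_homs_eq_if_chromatic_sym_fun_eq assms(2) G H by blast
      then have "graph_isomorphic G\<^sub>1 G\<^sub>2"
        using ex_bij[OF G(1,2)] ex_bij[OF G(2,1)] graph_isomorphic_if_bij_homs gr G by metis
      then show False using assms(3) G by blast
    qed
    then show ?thesis using H by (auto simp: distinguisher_def)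
  qed
  then show ?thesis unfolding uniformly_distinguishable_def by (intro exI[of _ "{H}"]) simp
qed

end
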